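(* Let $f:X\to X$ be a topologically transitive and topologically $GH$-stable homeomorphism of a nonempty compact metric space $X$. Then $f$ admits an invariant Borel probability measure with full support.
   Context: A homeomorphism $f:X\to X$ of a compact metric space is topologically transitive if there is a point $x\in X$ whose positive orbit $\{x,f(x),f^2(x),\dots\}$ is dense in $X$. A Borel probability measure $\mu$ on $X$ is invariant under $f$ if $\mu(f^{-1}(E))=\mu(E)$ for every Borel set $E\subset X$. Its support is $\mathrm{supp}(\mu)=\{x\in X:\mu(U)>0\text{ for every open neighborhood }U\text{ of }x\}$, and $\mu$ has full support if $\mathrm{supp}(\mu)=X$. Hausdorff distance: for nonempty subsets $A,B$ of a metric space $(X,d)$, $d_H(A,B)=\max\{\sup_{a\in A}\inf_{b\in B}d(a,b),\ \sup_{b\in B}\inf_{a\in A}d(a,b)\}$. $\Delta$-isometry: for compact metric spaces $(X,d^X)$, $(Y,d^Y)$ and $\Delta>0$, a map (not necessarily continuous) $i:X\to Y$ is a $\Delta$-isometry if $\max\{d_H(i(X),Y),\ \sup_{x,x'\in X}|d^Y(i(x),i(x'))-d^X(x,x')|\}<\Delta$. Uniform distance: for (not necessarily continuous) maps $u,v:Z\to W$ between metric spaces, $d_{C^0}(u,v)=\sup_{z\in Z}d^W(u(z),v(z))$. $C^0$-Gromov--Hausdorff distance: for continuous maps $f:X\to X$ and $g:Y\to Y$ of compact metric spaces, $d_{GH^0}(f,g)$ is the infimum of all $\Delta>0$ for which there exist $\Delta$-isometries $i:X\to Y$ and $j:Y\to X$ such that $d_{C^0}(g\circ i,i\circ f)<\Delta$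 and $d_{C^0}(j\circ g,f\circ j)<\Delta$. Topological $GH$-stability: a homeomorphism $f:X\to X$ of a compact metric space is topologically $GH$-stable if for every $\varepsilon>0$ there exists $\eta>0$ such that for every homeomorphism $g:Y\to Y$ of a compact metric space with $d_{GH^0}(f,g)<\eta$ there exists a continuous $\varepsilon$-isometry $h:Y\to X$ with $f\circ h=h\circ g$. *)

theory Defs
  imports "HOL-Analysis.Analysis"
begin

text \<open>
  Metric spaces are values of the library type \<open>'a metric\<close> (a carrier set together with a
  metric); maps between them are total functions of which only the values on the carrier matter.
\<close>

abbreviation self_homeomorphism :: "'a metric \<Rightarrow> ('a \<Rightarrow> 'a) \<Rightarrow> bool"
  where "self_homeomorphism X f \<equiv> homeomorphic_map (mtopology_of X) (mtopology_of X) f"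

definition topologically_transitive :: "'a metric \<Rightarrow> ('a \<Rightarrow> 'a) \<Rightarrow> bool"
  where "topologically_transitive X f \<longleftrightarrow>
    (\<exists>x\<in>mspace X. mtopology_of X closure_of (range (\<lambda>n. (f ^^ n) x)) = mspace X)"

definition borel_of :: "'a topology \<Rightarrow> 'a measure"
  where "borel_of T = sigma (topspace T) {U. openin T U}"

definition borel_prob_on :: "'a metric \<Rightarrow> 'a measure \<Rightarrow> bool"
  where "borel_prob_on X \<mu> \<longleftrightarrow>
    sets \<mu> = sets (borel_of (mtopology_of X)) \<and> emeasure \<mu> (mspace X) = 1"

definition invariant_measure :: "'a measure \<Rightarrow> ('a \<Rightarrow> 'a) \<Rightarrow> bool"
  where "invariant_measure \<mu> f \<longleftrightarrow>
    (\<forall>E\<in>sets \<mu>. emeasure \<mu> (f -` E \<inter> space \<mu>) = emeasure \<mu> E)"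

definition measure_support :: "'a metric \<Rightarrow> 'a measure \<Rightarrow> 'a set"
  where "measure_support X \<mu> =
    {x \<in> mspace X. \<forall>U. openin (mtopology_of X) U \<and> x \<in> U \<longrightarrow> emeasure \<mu> U > 0}"

text \<open>
  Suprema and infima of distances are taken in \<^typ>\<open>ereal\<close>, so that they are the mathematical
  ones without any boundedness side conditions.
\<close>

definition hausdorff_distance :: "'a metric \<Rightarrow> 'a set \<Rightarrow> 'a set \<Rightarrow> ereal"
  where "hausdorff_distance X A B =
    max (SUP a\<in>A. INF b\<in>B. ereal (mdist X a b)) (SUP b\<in>B. INF a\<in>A. ereal (mdist X a b))"

definition delta_isometry :: "real \<Rightarrow> 'a metric \<Rightarrow> 'b metric \<Rightarrow> ('a \<Rightarrow> 'b) \<Rightarrow> bool"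
  where "delta_isometry \<Delta> X Y i \<longleftrightarrow>
    i \<in> mspace X \<rightarrow> mspace Y \<and>
    max (hausdorff_distance Y (i ` mspace X) (mspace Y))
        (SUP (x, x')\<in>mspace X \<times> mspace X. ereal \<bar>mdist Y (i x) (i x') - mdist X x x'\<bar>)
      < ereal \<Delta>"

definition C0_distance :: "'a metric \<Rightarrow> 'b metric \<Rightarrow> ('a \<Rightarrow> 'b) \<Rightarrow> ('a \<Rightarrow> 'b) \<Rightarrow> ereal"
  where "C0_distance Z W u v = (SUP z\<in>mspace Z. ereal (mdist W (u z) (v z)))"

text \<open>The infimum is \<open>\<infinity>\<close> if there is no admissible \<open>\<Delta>\<close> (exactly one carrier empty).\<close>

definition GH0_distance ::
    "'a metric \<Rightarrow> ('a \<Rightarrow> 'a) \<Rightarrow> 'b metric \<Rightarrow> ('b \<Rightarrow> 'b) \<Rightarrow> ereal"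
  where "GH0_distance X f Y g =
    Inf {ereal \<Delta> | \<Delta>. \<Delta> > 0 \<and>
      (\<exists>i j. delta_isometry \<Delta> X Y i \<and> delta_isometry \<Delta> Y X j \<and>
        C0_distance X Y (g \<circ> i) (i \<circ> f) < ereal \<Delta> \<and>
        C0_distance Y X (j \<circ> g) (f \<circ> j) < ereal \<Delta>)}"

text \<open>
  Stability quantifies over all compact metric spaces \<open>Y\<close>. HOL formulas cannot quantify over
  types, so \<open>Y\<close> ranges over all metric spaces whose carrier is a set of real numbers, with an
  arbitrary metric unrelated to the usual distance on the reals. Up to isometry these are
  all compact metric spaces, by the following lemma, and everything below depends on \<open>(Y, g)\<close>
  only up to isometric conjugacy.
\<close>

lemma compact_metric_isometric_copy_in_real:
  fixes Y :: "'a metric"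
  assumes "compact_space (mtopology_of Y)"
  shows "\<exists>(Y' :: real metric) \<phi>. bij_betw \<phi> (mspace Y) (mspace Y') \<and>
    (\<forall>x\<in>mspace Y. \<forall>y\<in>mspace Y. mdist Y' (\<phi> x) (\<phi> y) = mdist Y x y)"
proof -
  interpret Metric_space "mspace Y" "mdist Y"
    by simp
  have "mtotally_bounded (mspace Y)"
    using assms compact_space_eq_mcomplete_mtotally_bounded by (simp add: mtopology_of_def)
  then have "\<forall>n::nat. \<exists>K. finite K \<and> K \<subseteq> mspace Y \<and>
      mspace Y \<subseteq> (\<Union>x\<in>K. mball x (inverse (Suc n)))"
    unfolding mtotally_bounded_def by (metis inverse_positive_iff_positive of_nat_0_less_iff zero_less_Suc)
  then obtain K where K: "\<And>n::nat. finite (K n)" "\<And>n. K n \<subseteq> mspace Y"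
      "\<And>n. mspace Y \<subseteq> (\<Union>x\<in>K n. mball x (inverse (Suc n)))"
    by metis
  define C where "C = (\<Union>n. K n)"
  have cC: "countable C"
    unfolding C_def using K(1) by (simp add: countable_finite)
  define code where
    "code x = {prod_encode (n, to_nat_on C k) | n k. k \<in> C \<and> x \<in> mball k (inverse (Suc n))}" for x
  have "inj_on code (mspace Y)"
  proof (rule inj_onI, rule ccontr)
    fix x y assume xy: "x \<in> mspace Y" "y \<in> mspace Y" "code x = code y" "x \<noteq> y"
    then obtain n where n: "inverse (real (Suc n)) < mdist Y x y / 2"
      using reals_Archimedean[of "mdist Y x y / 2"] mdist_pos_eq by auto
    obtain k where k: "k \<in> K n" "x \<in> mball k (inverse (Suc n))"
      using K(3)[of n] xy(1) by auto
    then have kC: "k \<in> C" by (auto simp: C_def)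
    then have "prod_encode (n, to_nat_on C k) \<in> code x"
      unfolding code_def using k(2) by blast
    then have "prod_encode (n, to_nat_on C k) \<in> code y"
      using xy(3) by simp
    then have "y \<in> mball k (inverse (Suc n))"
      using kC cC by (auto simp: code_def)
    with k(2) n xy show False
      using triangle[of x k y] commute[of x k] by auto
  qed
  moreover obtain e :: "nat set \<Rightarrow> real" where "inj e"
    using nat_sets_eqpoll_reals by (auto simp: eqpoll_def bij_betw_def)
  ultimately have inj: "inj_on (e \<circ> code) (mspace Y)"
    by (meson comp_inj_on inj_on_subset subset_UNIV)
  define \<phi> where "\<phi> = e \<circ> code"
  define \<psi> where "\<psi> = inv_into (mspace Y) \<phi>"
  have \<psi>: "\<And>x. x \<in> mspace Y \<Longrightarrow> \<psi> (\<phi> x) = x"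
    unfolding \<psi>_def using inj by (metis \<phi>_def inv_into_f_f)
  interpret M: Metric_space "\<phi> ` mspace Y" "\<lambda>r s. mdist Y (\<psi> r) (\<psi> s)"
    by unfold_locales (auto simp: \<psi> commute triangle)
  show ?thesis
    by (rule exI[of _ "metric (\<phi> ` mspace Y, \<lambda>r s. mdist Y (\<psi> r) (\<psi> s))"], rule exI[of _ \<phi>])
      (use inj[folded \<phi>_def] \<psi> in \<open>simp add: bij_betw_def\<close>)
qed

definition topologically_GH_stable :: "'a metric \<Rightarrow> ('a \<Rightarrow> 'a) \<Rightarrow> bool"
  where "topologically_GH_stable X f \<longleftrightarrow>
    (\<forall>\<epsilon>>0. \<exists>\<eta>>0. \<forall>(Y :: real metric) g.
      compact_space (mtopology_of Y) \<and> self_homeomorphism Y g \<and>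
      GH0_distance X f Y g < ereal \<eta> \<longrightarrow>
      (\<exists>h. continuous_map (mtopology_of Y) (mtopology_of X) h \<and> delta_isometry \<epsilon> Y X h \<and>
        (\<forall>y\<in>mspace Y. f (h y) = h (g y))))"

end

theory Submission
  imports Defs "HOL-Probability.Probability_Mass_Function"
begin

text \<open>
  A point \<open>x\<close> with dense orbit is recurrent, so some segment \<open>x, f x, \<dots>, f\<^sup>n\<^sup>-\<^sup>1 x\<close> is dense up to
  a small error and almost closes up. Joining its ends gives a cyclic permutation of a finite metric
  space that is \<open>GH\<^sup>0\<close>-close to \<open>f\<close>; by stability it is mapped to a finite \<open>f\<close>-invariant set which is
  \<open>\<epsilon>\<close>-dense in \<open>X\<close>. The uniform distributions on such sets for \<open>\<epsilon> = 1/(m+1)\<close>, averaged with geometric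
  weights, form an invariant measure that is positive on every nonempty open set.
\<close>

section \<open>Estimates for approximate isometries and the Gromov-Hausdorff distance\<close>

text \<open>Suprema weaken strict pointwise bounds to non-strict ones, hence a constant
  \<open>c\<close> strictly below \<open>\<Delta>\<close>. In the Hausdorff distance only density of
  the image costs anything: an image point lies in \<open>mspace Y\<close>, at distance 0 from
  itself.\<close>

lemma delta_isometryI:
  assumes "i \<in> mspace X \<rightarrow> mspace Y" "0 \<le> c" "c < \<Delta>"
    and dense: "\<And>y. y \<in> mspace Y \<Longrightarrow> \<exists>x\<in>mspace X. mdist Y (i x) y \<le> c"
    and dist: "\<And>x x'. x \<in> mspace X \<Longrightarrow> x' \<in> mspace X \<Longrightarrow>
      \<bar>mdist Y (i x) (i x') - mdist X x x'\<bar> \<le> c"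
  shows "delta_isometry \<Delta> X Y i"
proof -
  interpret Y: Metric_space "mspace Y" "mdist Y"
    by simp
  have "(INF b\<in>mspace Y. ereal (mdist Y a b)) \<le> ereal c" if "a \<in> i ` mspace X" for a
    using that assms(1,2) by (intro INF_lower2[of a]) (auto simp: Pi_iff)
  moreover have "(INF a\<in>i ` mspace X. ereal (mdist Y a b)) \<le> ereal c" if "b \<in> mspace Y" for b
    using dense[OF that] by (auto intro: INF_lower2)
  ultimately have "hausdorff_distance Y (i ` mspace X) (mspace Y) \<le> ereal c"
    unfolding hausdorff_distance_def by (auto intro!: SUP_least)
  moreover have "(SUP (x, x')\<in>mspace X \<times> mspace X.
      ereal \<bar>mdist Y (i x) (i x') - mdist X x x'\<bar>) \<le> ereal c"
    using dist by (auto intro!: SUP_least)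
  moreover have "ereal c < ereal \<Delta>"
    using assms by simp
  ultimately show ?thesis
    unfolding delta_isometry_def using assms(1) by (simp add: le_less_trans)
qed

lemma delta_isometry_dense:
  assumes "delta_isometry \<Delta> X Y i" "y \<in> mspace Y"
  shows "\<exists>x\<in>mspace X. mdist Y (i x) y < \<Delta>"
proof -
  have "(INF a\<in>i ` mspace X. ereal (mdist Y a y))
      \<le> hausdorff_distance Y (i ` mspace X) (mspace Y)"
    unfolding hausdorff_distance_def using assms(2)
    by (intro max.coboundedI2 SUP_upper2[of y]) auto
  also have "\<dots> < ereal \<Delta>"
    using assms(1) by (simp add: delta_isometry_def)
  finally show ?thesis
    by (auto simp: INF_less_iff)
qed

lemma C0_distance_less:
  assumes "\<And>z. z \<in> mspace Z \<Longrightarrow> mdist W (u z) (v z) \<le> c" "c < \<Delta>"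
  shows "C0_distance Z W u v < ereal \<Delta>"
proof -
  have "C0_distance Z W u v \<le> ereal c"
    unfolding C0_distance_def using assms(1) by (auto intro: SUP_least)
  also have "\<dots> < ereal \<Delta>"
    using assms(2) by simp
  finally show ?thesis .
qed

lemma GH0_distance_le:
  assumes "\<Delta> > 0" "delta_isometry \<Delta> X Y i" "delta_isometry \<Delta> Y X j"
    and "C0_distance X Y (g \<circ> i) (i \<circ> f) < ereal \<Delta>"
    and "C0_distance Y X (j \<circ> g) (f \<circ> j) < ereal \<Delta>"
  shows "GH0_distance X f Y g \<le> ereal \<Delta>"
  unfolding GH0_distance_def using assms by (intro Inf_lower) blast

section \<open>Uniformly discrete metric spaces\<close>

lemma openin_separated_metric:
  assumes "e > 0" "\<And>x y. x \<in> mspace Y \<Longrightarrow> y \<in> mspace Y \<Longrightarrow> x \<noteq> y \<Longrightarrow> e \<le> mdist Y x y"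
  shows "openin (mtopology_of Y) U \<longleftrightarrow> U \<subseteq> mspace Y"
proof -
  interpret Metric_space "mspace Y" "mdist Y"
    by simp
  have "mball x e \<subseteq> {x}" for x
    using assms(2) by (fastforce simp: mball_def)
  then show ?thesis
    unfolding mtopology_of_def openin_mtopology using assms(1) by blast
qed

text \<open>All subsets of the carrier are open, so the topological clauses of a quotient map hold
  trivially and bijectivity is enough.\<close>

lemma self_homeomorphism_separated_finite:
  assumes "e > 0" "\<And>x y. x \<in> mspace Y \<Longrightarrow> y \<in> mspace Y \<Longrightarrow> x \<noteq> y \<Longrightarrow> e \<le> mdist Y x y"
    and "g ` mspace Y = mspace Y" "inj_on g (mspace Y)"
  shows "self_homeomorphism Y g"
  unfolding homeomorphic_map_def quotient_map_def
  using assms(3,4) by (auto simp: openin_separated_metric[OF assms(1,2)])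

section \<open>Finite cyclic models of a closed pseudo-orbit\<close>

lemma inj_on_Suc_mod: "inj_on (\<lambda>k. Suc k mod n) {..<n}"
proof (rule inj_onI)
  fix k l assume "k \<in> {..<n}" "l \<in> {..<n}" "Suc k mod n = Suc l mod n"
  then show "k = l"
    by (cases "Suc k = n"; cases "Suc l = n") auto
qed

text \<open>Adding \<open>e\<close> to the distance of distinct indices makes the pulled back pseudometric a metric even
  if the pseudo-orbit visits a point twice.\<close>

lemma pseudo_orbit_GH0_close:
  fixes p :: "nat \<Rightarrow> 'a" and X :: "'a metric"
  assumes "n > 0" "e > 0" "\<delta> \<le> e" "f \<in> mspace X \<rightarrow> mspace X"
    and p: "\<And>k. k < n \<Longrightarrow> p k \<in> mspace X"
    and net: "\<And>z. z \<in> mspace X \<Longrightarrow> \<exists>k<n. mdist X (p k) z < \<delta>"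
    and step: "\<And>k. k < n \<Longrightarrow> mdist X (f (p k)) (p (Suc k mod n)) < e"
    and unif: "\<And>a b. a \<in> mspace X \<Longrightarrow> b \<in> mspace X \<Longrightarrow> mdist X a b < \<delta> \<Longrightarrow>
      mdist X (f a) (f b) < e"
  obtains Y :: "real metric" and g where "finite (mspace Y)" "mspace Y \<noteq> {}"
    "self_homeomorphism Y g" "GH0_distance X f Y g \<le> ereal (6 * e)"
proof -
  interpret X: Metric_space "mspace X" "mdist X"
    by simp
  \<comment> \<open>Stability speaks of metrics on sets of reals, so the indices below
    \<open>n\<close> are embedded as reals; \<open>idx\<close> recovers them.\<close>
  define idx where "idx r = nat \<lfloor>r\<rfloor>" for r :: real
  have idx [simp]: "idx (real k) = k" for k
    by (simp add: idx_def)
  define M where "M = real ` {..<n}"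
  define d where "d r s = mdist X (p (idx r)) (p (idx s)) + (if r = s then 0 else e)" for r s
  have M: "idx r < n" "p (idx r) \<in> mspace X" "real (idx r) = r" if "r \<in> M" for r
    using that p by (auto simp: M_def)
  interpret Y: Metric_space M d
  proof
    show "0 \<le> d r s" for r s
      using assms(2) by (simp add: d_def)
    show "d r s = d s r" for r s
      by (simp add: d_def X.commute)
    show "(d r s = 0) = (r = s)" if "r \<in> M" "s \<in> M" for r s
      using assms(2) M(2)[OF that(1)] by (auto simp: d_def add_nonneg_eq_0_iff)
    \<comment> \<open>If \<open>r\<close> and \<open>t\<close> differ, then \<open>s\<close> differs
      from one of them, so the extra \<open>e\<close> on the left also occurs on the right.\<close>
    show "d r t \<le> d r s + d s t" if "r \<in> M" "s \<in> M" "t \<in> M" for r s t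
      using assms(2) X.triangle[OF that[THEN M(2)]] by (auto simp: d_def)
  qed
  define Y where "Y = metric (M, d)"
  have Y [simp]: "mspace Y = M" "mdist Y = d"
    by (simp_all add: Y_def)
  define g where "g r = real (Suc (idx r) mod n)" for r
  have gM: "g r \<in> M" for r
    using assms(1) by (simp add: g_def M_def)
  have finM: "finite M"
    by (simp add: M_def)
  have "inj_on g M"
  proof (rule inj_onI)
    fix r s assume rs: "r \<in> M" "s \<in> M" "g r = g s"
    then have "idx r = idx s"
      using inj_onD[OF inj_on_Suc_mod[of n], of "idx r" "idx s"] M(1) by (simp add: g_def)
    then show "r = s"
      using M(3) rs by metis
  qed
  moreover from this have "g ` M = M"
    using gM finM by (intro endo_inj_surj) auto
  ultimately have homeo: "self_homeomorphism Y g"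
    using assms(2) by (intro self_homeomorphism_separated_finite[of e]) (auto simp: d_def)
  \<comment> \<open>\<open>i\<close> chooses the index of some pseudo-orbit point within
    \<open>\<delta>\<close>, with no continuity; \<open>j\<close> returns the point with a given
    index.\<close>
  define i where "i z = real (SOME k. k < n \<and> mdist X (p k) z < \<delta>)" for z
  define j where "j r = p (idx r)" for r
  have i: "i z \<in> M" "mdist X (p (idx (i z))) z < \<delta>" if "z \<in> mspace X" for z
    using someI_ex[OF net[OF that]] by (auto simp: i_def M_def)
  have i': "mdist X (p (idx (i z))) z < e" "mdist X z (p (idx (i z))) < e"
      if "z \<in> mspace X" for z
    using i(2)[OF that] assms(3) by (auto simp: X.commute)
  have iM: "p (idx (i z)) \<in> mspace X" if "z \<in> mspace X" for z
    using i(1)[OF that] by (rule M(2))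
  have fM: "f z \<in> mspace X" if "z \<in> mspace X" for z
    using that assms(4) by auto
  \<comment> \<open>The bound \<open>5 * e\<close> serves all four estimates, and
    \<open>6 * e\<close> lies strictly above it. The largest error is that of
    \<open>g \<circ> i\<close> against \<open>i \<circ> f\<close>: three distances below
    \<open>e\<close> plus the summand \<open>e\<close> in \<open>d\<close>.\<close>
  have "delta_isometry (6 * e) X Y i"
  proof (rule delta_isometryI[of _ _ _ "5 * e"])
    \<comment> \<open>For the point with index \<open>y\<close>, \<open>i\<close> may choose a
      different index, but only of a point closer than \<open>e\<close>; the summand in
      \<open>d\<close> adds at most another \<open>e\<close>.\<close>
    show "\<exists>x\<in>mspace X. mdist Y (i x) y \<le> 5 * e" if "y \<in> mspace Y" for y
      using that assms(2) M(2)[of y] i'(1)[of "p (idx y)"]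
      by (intro bexI[of _ "p (idx y)"]) (auto simp: d_def)
    \<comment> \<open>Each of the two points is displaced by less than \<open>e\<close>, and
      \<open>d\<close> adds at most \<open>e\<close>.\<close>
    show "\<bar>mdist Y (i x) (i x') - mdist X x x'\<bar> \<le> 5 * e"
      if "x \<in> mspace X" "x' \<in> mspace X" for x x'
      using that iM[OF that(1)] iM[OF that(2)] i'[OF that(1)] i'[OF that(2)] assms(2)
        X.triangle[of "p (idx (i x))" x "p (idx (i x'))"]
        X.triangle[of x x' "p (idx (i x'))"]
        X.triangle[of x "p (idx (i x))" x'] X.triangle[of "p (idx (i x))" "p (idx (i x'))" x']
      by (auto simp: d_def)
  qed (use i assms(2) in auto)
  moreover have "delta_isometry (6 * e) Y X j"
  proof (rule delta_isometryI[of _ _ _ "5 * e"])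
    show "\<exists>x\<in>mspace Y. mdist X (j x) y \<le> 5 * e" if "y \<in> mspace X" for y
      using that i[OF that] i'[OF that] assms(2) by (intro bexI[of _ "i y"]) (auto simp: j_def)
    show "\<bar>mdist X (j x) (j x') - mdist Y x x'\<bar> \<le> 5 * e"
      if "x \<in> mspace Y" "x' \<in> mspace Y" for x x'
      using assms(2) by (simp add: d_def j_def)
  qed (use assms(2) M in \<open>auto simp: j_def\<close>)
  moreover have "C0_distance X Y (g \<circ> i) (i \<circ> f) < ereal (6 * e)"
  proof (rule C0_distance_less[of _ _ _ _ "5 * e"])
    fix z assume z: "z \<in> mspace X"
    let ?k = "idx (i z)"
    have k: "?k < n" "p ?k \<in> mspace X" "f (p ?k) \<in> mspace X" "p (Suc ?k mod n) \<in> mspace X"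
        "p (idx (i (f z))) \<in> mspace X"
      using z i M iM fM p assms(1) by simp_all
    \<comment> \<open>The three links of the chain: the jump of the pseudo-orbit, uniform continuity
      of \<open>f\<close> at the approximation of \<open>z\<close>, and the choice of
      \<open>i\<close> at \<open>f z\<close>.\<close>
    have "mdist X (f (p ?k)) (p (Suc ?k mod n)) < e" "mdist X (f (p ?k)) (f z) < e"
        "mdist X (f z) (p (idx (i (f z)))) < e"
      using step[OF k(1)] unif[OF k(2) z i(2)[OF z]] i'[OF fM[OF z]] by auto
    then show "mdist Y ((g \<circ> i) z) ((i \<circ> f) z) \<le> 5 * e"
      using k fM[OF z] assms(2) X.commute[of "f (p ?k)" "p (Suc ?k mod n)"]
        X.triangle[of "p (Suc ?k mod n)" "f (p ?k)" "p (idx (i (f z)))"]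
        X.triangle[of "f (p ?k)" "f z" "p (idx (i (f z)))"]
      by (auto simp: d_def g_def)
  qed (use assms(2) in auto)
  moreover have "C0_distance Y X (j \<circ> g) (f \<circ> j) < ereal (6 * e)"
  proof (rule C0_distance_less[of _ _ _ _ "5 * e"])
    show "mdist X ((j \<circ> g) r) ((f \<circ> j) r) \<le> 5 * e" if "r \<in> mspace Y" for r
      using that step[of "idx r"] M(1)[of r] assms(2)
      by (simp add: j_def g_def X.commute)
  qed (use assms(2) in auto)
  ultimately have "GH0_distance X f Y g \<le> ereal (6 * e)"
    using assms(2) by (intro GH0_distance_le) auto
  then show thesis
    using that[of Y g] homeo finM assms(1) by (auto simp: M_def)
qed

section \<open>Recurrence and quantitative density of a dense orbit\<close>

lemma funpow_continuous_map:
  assumes "continuous_map T T f"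
  shows "continuous_map T T (f ^^ n)"
proof (induction n)
  case (Suc n)
  then show ?case
    using continuous_map_compose[OF Suc assms] by (simp only: funpow.simps)
qed (simp add: id_def)

text \<open>The point of the dense orbit is recurrent: the orbit comes close to the preimage of \<open>x\<close>
  under \<open>f\<^sup>N\<close>, hence \<open>f\<^sup>N\<close> brings it back close to \<open>x\<close>.\<close>

lemma dense_orbit_returns:
  fixes X :: "'a metric"
  assumes f: "self_homeomorphism X f" and "x \<in> mspace X" "e > 0"
    and dense: "mtopology_of X closure_of range (\<lambda>n. (f ^^ n) x) = mspace X"
  shows "\<exists>n\<ge>N. mdist X ((f ^^ n) x) x < e"
proof -
  interpret X: Metric_space "mspace X" "mdist X"
    by simp
  have cont: "continuous_map X.mtopology X.mtopology (f ^^ N)"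
    using funpow_continuous_map[OF homeomorphic_imp_continuous_map[OF f]]
    by (simp add: mtopology_of_def)
  have im: "f ` mspace X = mspace X"
    using homeomorphic_imp_surjective_map[OF f] by simp
  have "(f ^^ N) ` mspace X = mspace X"
  proof (induction N)
    case (Suc N)
    then show ?case
      unfolding funpow.simps image_comp[symmetric] by (simp only: im)
  qed simp
  then obtain y where y: "y \<in> mspace X" "(f ^^ N) y = x"
    using assms(2) by (metis imageE)
  obtain r where r: "r > 0" "\<And>z. z \<in> mspace X \<Longrightarrow> mdist X y z < r \<Longrightarrow> (f ^^ N) z \<in> X.mball x e"
    using cont y assms(2,3) unfolding X.continuous_map_from_metric
    by (metis X.centre_in_mball_iff X.openin_mball)
  have "y \<in> X.mtopology closure_of range (\<lambda>n. (f ^^ n) x)"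
    using dense y(1) by (simp add: mtopology_of_def)
  then obtain k where "(f ^^ k) x \<in> X.mball y r"
    using r(1) unfolding X.metric_closure_of by auto
  then have "(f ^^ N) ((f ^^ k) x) \<in> X.mball x e"
    using r(2) by auto
  then show ?thesis
    by (intro exI[of _ "N + k"]) (auto simp: funpow_add X.commute)
qed

text \<open>The \<open>e\<close>-balls around the points of the sequence cover the space.
  Compactness leaves finitely many, and \<open>N\<close> exceeds all their indices.\<close>

lemma dense_orbit_initial_segment:
  fixes X :: "'a metric"
  assumes "compact_space (mtopology_of X)" "e > 0"
    and dense: "mtopology_of X closure_of range u = mspace X"
  shows "\<exists>N::nat. \<forall>z\<in>mspace X. \<exists>k<N. mdist X (u k) z < e"
proof -
  interpret X: Metric_space "mspace X" "mdist X"
    by simp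
  have comp: "compactin X.mtopology (mspace X)"
    using assms(1) by (simp add: mtopology_of_def compact_space_def)
  have "mspace X \<subseteq> (\<Union>k. X.mball (u k) e)"
  proof
    fix z assume z: "z \<in> mspace X"
    then have "z \<in> X.mtopology closure_of range u"
      using dense by (simp add: mtopology_of_def)
    then obtain k where "u k \<in> X.mball z e"
      using assms(2) unfolding X.metric_closure_of by auto
    then show "z \<in> (\<Union>k. X.mball (u k) e)"
      by (auto simp: X.commute)
  qed
  then obtain F where "finite F" "F \<subseteq> range (\<lambda>k. X.mball (u k) e)" "mspace X \<subseteq> \<Union>F"
    using comp unfolding compactin_def by (metis (no_types, lifting) X.openin_mball imageE)
  then obtain K where K: "finite K" "mspace X \<subseteq> (\<Union>k\<in>K. X.mball (u k) e)"
    by (metis finite_subset_image)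
  \<comment> \<open>Inserting 0 keeps \<open>Max\<close> well defined when \<open>K\<close> is
    empty.\<close>
  have "\<forall>z\<in>mspace X. \<exists>k<Suc (Max (insert 0 K)). mdist X (u k) z < e"
  proof (intro ballI)
    fix z assume "z \<in> mspace X"
    then obtain k where "k \<in> K" "mdist X (u k) z < e"
      using K(2) by auto
    then show "\<exists>k<Suc (Max (insert 0 K)). mdist X (u k) z < e"
      using K(1) by (intro exI[of _ k]) (simp add: less_Suc_eq_le)
  qed
  then show ?thesis
    by blast
qed

section \<open>Finite invariant sets from stability\<close>

text \<open>The set is the image of the cyclic model under the semiconjugacy \<open>h\<close>:
  surjectivity of \<open>g\<close> gives invariance, and the Hausdorff part of the
  \<open>\<epsilon>\<close>-isometry gives density.\<close>

lemma finite_dense_invariant_set: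
  fixes X :: "'a metric"
  assumes comp: "compact_space (mtopology_of X)" and f: "self_homeomorphism X f"
    and "topologically_transitive X f" and stable: "topologically_GH_stable X f"
    and "\<epsilon> > 0"
  shows "\<exists>A. finite A \<and> A \<noteq> {} \<and> A \<subseteq> mspace X \<and> f ` A = A \<and>
    (\<forall>z\<in>mspace X. \<exists>a\<in>A. mdist X a z < \<epsilon>)"
proof -
  interpret X: Metric_space "mspace X" "mdist X"
    by simp
  obtain \<eta> where \<eta>: "\<eta> > 0" and h: "\<And>(Y :: real metric) g. compact_space (mtopology_of Y) \<Longrightarrow>
      self_homeomorphism Y g \<Longrightarrow> GH0_distance X f Y g < ereal \<eta> \<Longrightarrow>
      \<exists>h. continuous_map (mtopology_of Y) (mtopology_of X) h \<and> delta_isometry \<epsilon> Y X h \<and>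
        (\<forall>y\<in>mspace Y. f (h y) = h (g y))"
    using stable \<open>\<epsilon> > 0\<close> unfolding topologically_GH_stable_def by meson
  \<comment> \<open>The model is only known to be at distance at most \<open>6 * e\<close>, while
    stability asks for strictly less than \<open>\<eta>\<close>.\<close>
  define e where "e = \<eta> / 7"
  have e: "e > 0" "6 * e < \<eta>"
    using \<eta> by (auto simp: e_def)
  have fX: "f \<in> mspace X \<rightarrow> mspace X"
    using homeomorphic_imp_surjective_map[OF f] by auto
  have "uniformly_continuous_map X X f"
    using comp homeomorphic_imp_continuous_map[OF f] continuous_imp_uniformly_continuous_map
    by blast
  then obtain \<delta>0 where \<delta>0: "\<delta>0 > 0" "\<And>a b. a \<in> mspace X \<Longrightarrow> b \<in> mspace X \<Longrightarrow>
      mdist X a b < \<delta>0 \<Longrightarrow> mdist X (f a) (f b) < e"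
    unfolding uniformly_continuous_map_def using e(1) by meson
  define \<delta> where "\<delta> = min \<delta>0 e"
  have \<delta>: "\<delta> > 0" "\<delta> \<le> e" "\<And>a b. a \<in> mspace X \<Longrightarrow> b \<in> mspace X \<Longrightarrow>
      mdist X a b < \<delta> \<Longrightarrow> mdist X (f a) (f b) < e"
    using \<delta>0 e by (auto simp: \<delta>_def)
  obtain x where x: "x \<in> mspace X"
      "mtopology_of X closure_of range (\<lambda>n. (f ^^ n) x) = mspace X"
    using assms(3) unfolding topologically_transitive_def by blast
  have orb: "(f ^^ k) x \<in> mspace X" for k
    using fX x(1) by (induction k) auto
  obtain N where N: "\<And>z. z \<in> mspace X \<Longrightarrow> \<exists>k<N. mdist X ((f ^^ k) x) z < \<delta>"
    using dense_orbit_initial_segment[OF comp \<delta>(1) x(2)] by blast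
  then have "N > 0"
    using x(1) by fastforce
  \<comment> \<open>A return time beyond \<open>N\<close> keeps the first \<open>n\<close> orbit
    points \<open>\<delta>\<close>-dense and closes them up within \<open>e\<close>.\<close>
  obtain n where n: "n \<ge> N" "mdist X ((f ^^ n) x) x < e"
    using dense_orbit_returns[OF f x(1) e(1) x(2)] by blast
  obtain Y :: "real metric" and g where Y: "finite (mspace Y)" "mspace Y \<noteq> {}"
      "self_homeomorphism Y g" "GH0_distance X f Y g \<le> ereal (6 * e)"
  proof (rule pseudo_orbit_GH0_close[of n e \<delta> f X "\<lambda>k. (f ^^ k) x"])
    show "\<exists>k<n. mdist X ((f ^^ k) x) z < \<delta>" if "z \<in> mspace X" for z
      using N[OF that] n(1) by (meson less_le_trans)
    show "mdist X (f ((f ^^ k) x)) ((f ^^ (Suc k mod n)) x) < e" if "k < n" for k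
    \<comment> \<open>Only the closing jump from the last point back to \<open>x\<close> has an
      error; every other step follows the orbit exactly.\<close>
    proof (cases "Suc k = n")
      case True
      then show ?thesis
        using n(2) by auto
    next
      case False
      then show ?thesis
        using that e(1) orb[of "Suc k"] by simp
    qed
  qed (use \<open>N > 0\<close> n e \<delta> fX orb in auto)
  have "compact_space (mtopology_of Y)"
    using Y(1) by (simp add: compact_space_def finite_imp_compactin)
  moreover have "GH0_distance X f Y g < ereal \<eta>"
    using Y(4) e(2) by (meson ereal_less(1) le_less_trans less_ereal.simps(1))
  ultimately obtain h where h: "delta_isometry \<epsilon> Y X h" "\<And>y. y \<in> mspace Y \<Longrightarrow> f (h y) = h (g y)"
    using h[OF _ Y(3)] by blast
  have gY: "g ` mspace Y = mspace Y"
    using homeomorphic_imp_surjective_map[OF Y(3)] by simp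
  show ?thesis
  proof (intro exI[of _ "h ` mspace Y"] conjI ballI)
    show "h ` mspace Y \<subseteq> mspace X"
      using h(1) by (auto simp: delta_isometry_def)
    have "f ` h ` mspace Y = h ` g ` mspace Y"
      using h(2) by (auto simp: image_image)
    then show "f ` h ` mspace Y = h ` mspace Y"
      by (simp add: gY)
    show "\<exists>a\<in>h ` mspace Y. mdist X a z < \<epsilon>" if "z \<in> mspace X" for z
      using delta_isometry_dense[OF h(1) that] by auto
  qed (use Y in auto)
qed

section \<open>The invariant Borel measure\<close>

lemma sets_borel_of: "sets (borel_of T) = sigma_sets (topspace T) {U. openin T U}"
  and space_borel_of [simp]: "space (borel_of T) = topspace T"
  unfolding borel_of_def
  by (subst sets_measure_of space_measure_of; auto dest: openin_subset)+

lemma measurable_borel_of: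
  assumes "continuous_map S T f"
  shows "f \<in> borel_of S \<rightarrow>\<^sub>M borel_of T"
proof (rule measurable_sigma_sets[OF sets_borel_of])
  show "f -` U \<inter> space (borel_of S) \<in> sets (borel_of S)" if "U \<in> {U. openin T U}" for U
    using openin_continuous_map_preimage[OF assms, of U] that
    by (auto simp: sets_borel_of vimage_def Int_def conj_commute)
qed (use assms openin_subset in \<open>auto simp: continuous_map_def\<close>)

theorem proposition4p5:
  fixes X :: "'a metric" and f :: "'a \<Rightarrow> 'a"
  assumes "mspace X \<noteq> {}"
    and "compact_space (mtopology_of X)"
    and "self_homeomorphism X f"
    and "topologically_transitive X f"
    and "topologically_GH_stable X f"
  shows "\<exists>\<mu>. borel_prob_on X \<mu> \<and> invariant_measure \<mu> f \<and> measure_support X \<mu> = mspace X"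
proof -
  interpret X: Metric_space "mspace X" "mdist X"
    by simp
  have "\<forall>m. \<exists>A. finite A \<and> A \<noteq> {} \<and> A \<subseteq> mspace X \<and> f ` A = A \<and>
      (\<forall>z\<in>mspace X. \<exists>a\<in>A. mdist X a z < inverse (real (Suc m)))"
    using finite_dense_invariant_set[OF assms(2-5)] by simp
  then obtain A where A: "\<And>m. finite (A m)" "\<And>m. A m \<noteq> {}" "\<And>m. A m \<subseteq> mspace X"
      "\<And>m. f ` A m = A m"
      "\<And>m z. z \<in> mspace X \<Longrightarrow> \<exists>a\<in>A m. mdist X a z < inverse (real (Suc m))"
    by metis
  \<comment> \<open>The set \<open>A m\<close> is drawn with probability
    \<open>1 / 2 ^ (m + 1)\<close>. As all these weights are positive, every point of every
    \<open>A m\<close> is an atom.\<close>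
  define p where "p = geometric_pmf (1/2) \<bind> (\<lambda>m. pmf_of_set (A m))"
  have set_p: "set_pmf p = (\<Union>m. A m)"
    using A by (simp add: p_def set_pmf_geometric)
  \<comment> \<open>A map of a finite set onto itself is injective there, so it preserves the
    uniform distribution.\<close>
  have "map_pmf f (pmf_of_set (A m)) = pmf_of_set (A m)" for m
    using map_pmf_of_set_inj[of f "A m"] A eq_card_imp_inj_on[of "A m" f] by simp
  then have map_p: "map_pmf f p = p"
    by (simp add: p_def map_bind_pmf)
  \<comment> \<open>\<open>p\<close> lives on the whole type, but all its atoms lie in the
    carrier.\<close>
  have p_X: "emeasure p (E \<inter> mspace X) = emeasure p E" for E
    using A(3) by (subst (1 2) emeasure_Int_set_pmf[symmetric])
      (auto simp: set_p intro: arg_cong[where f = "emeasure p"])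
  define B where "B = borel_of (mtopology_of X)"
  have sB: "space B = mspace X"
    by (simp add: B_def)
  \<comment> \<open>\<open>p\<close> measures every subset of the type. Restriction cuts the space
    down to the carrier, and pushing forward along the identity cuts the sigma-algebra down to the
    Borel sets.\<close>
  define \<mu> where "\<mu> = distr (restrict_space p (mspace X)) B (\<lambda>z. z)"
  have sets_\<mu>: "sets \<mu> = sets B" "space \<mu> = mspace X"
    by (simp_all add: \<mu>_def sB)
  have \<mu>: "emeasure \<mu> E = emeasure p E" if "E \<in> sets B" for E
  proof -
    have E: "E \<subseteq> mspace X"
      using sets.sets_into_space[OF that] by (simp add: sB)
    have "(\<lambda>z. z) \<in> restrict_space p (mspace X) \<rightarrow>\<^sub>M B"
      by (rule measurableI) (auto simp: sB space_restrict_space sets_restrict_space)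
    then show ?thesis
      unfolding \<mu>_def using that E
      by (simp add: emeasure_distr emeasure_restrict_space space_restrict_space Int_absorb2)
  qed
  have openB: "U \<in> sets B" if "openin (mtopology_of X) U" for U
    using that by (auto simp: B_def sets_borel_of)
  have "emeasure \<mu> (mspace X) = 1"
    using \<mu>[of "mspace X"] p_X[of UNIV] sets.top[of B] sB measure_pmf.emeasure_space_1[of p] by simp
  then have "borel_prob_on X \<mu>"
    by (simp add: borel_prob_on_def sets_\<mu> B_def)
  moreover have "invariant_measure \<mu> f"
    unfolding invariant_measure_def sets_\<mu>
  proof
    fix E assume E: "E \<in> sets B"
    have "f \<in> B \<rightarrow>\<^sub>M B"
      unfolding B_def using assms(3) by (intro measurable_borel_of homeomorphic_imp_continuous_map)
    then have "f -` E \<inter> mspace X \<in> sets B"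
      using measurable_sets[OF _ E] sB by metis
    \<comment> \<open>Dropping the intersection with the carrier turns the preimage measure into
      that of \<open>map_pmf f p\<close>, which equals \<open>p\<close>.\<close>
    then have "emeasure \<mu> (f -` E \<inter> mspace X) = emeasure p (f -` E)"
      using \<mu> p_X by simp
    also have "\<dots> = emeasure (map_pmf f p) E"
      by simp
    finally show "emeasure \<mu> (f -` E \<inter> mspace X) = emeasure \<mu> E"
      using \<mu>[OF E] map_p by simp
  qed
  moreover have "emeasure \<mu> U > 0" if "openin (mtopology_of X) U" "z \<in> U" for U z
  proof -
    have "X.mtopology = mtopology_of X"
      by (simp add: mtopology_of_def)
    then have U: "U \<subseteq> mspace X" "\<exists>r>0. X.mball z r \<subseteq> U"
      using that X.openin_mtopology by metis+
    then obtain r where r: "r > 0" "X.mball z r \<subseteq> U"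
      by blast
    have z: "z \<in> mspace X"
      using U(1) that(2) by blast
    \<comment> \<open>Once \<open>1 / (m + 1)\<close> is below the radius, the ball around
      \<open>z\<close> contains a point of \<open>A m\<close>, which is an atom of
      \<open>p\<close>.\<close>
    obtain m where m: "inverse (real (Suc m)) < r"
      using reals_Archimedean[OF r(1)] by blast
    obtain a where a: "a \<in> A m" "mdist X a z < inverse (real (Suc m))"
      using A(5)[OF z] by blast
    then have "a \<in> X.mball z r"
      using m z A(3) X.commute[of a z] by auto
    then have "a \<in> set_pmf p \<inter> U"
      using a(1) r(2) by (auto simp: set_p)
    then have "measure p U \<noteq> 0"
      by (auto simp: measure_pmf_zero_iff)
    then show ?thesis
      using \<mu>[OF openB[OF that(1)]]
      by (simp add: measure_pmf.emeasure_eq_measure zero_less_measure_iff)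
  qed
  then have "measure_support X \<mu> = mspace X"
    by (auto simp: measure_support_def)
  ultimately show ?thesis
    by blast
qed

end
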